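(* Let $n\ge 4$. For integers $a,a'$ with $0\le a<a'\le\lfloor\frac{n-4}{2}\rfloor$, $$\xi_1\big((T_{n,3}^{a,n-4-a})^c\big)>\xi_1\big((T_{n,3}^{a',n-4-a'})^c\big).$$ That is, $\xi_1\big((T_{n,3}^{0,n-4})^c\big)>\xi_1\big((T_{n,3}^{1,n-5})^c\big)>\cdots>\xi_1\big((T_{n,3}^{\lfloor\frac{n-4}{2}\rfloor,\lceil\frac{n-4}{2}\rceil})^c\big)$.
   Context: For a connected graph $G$, the eccentricity matrix $\mathcal{E}(G)$ is the matrix indexed by $V(G)$ whose $(u,v)$-entry is $d_G(u,v)$ if $d_G(u,v)=\min\{e_G(u),e_G(v)\}$ and $0$ otherwise, where $d_G$ is the graph distance and $e_G(u)=\max_v d_G(u,v)$. Its eigenvalues are real and ordered $\xi_1(G)\ge\xi_2(G)\ge\cdots\ge\xi_n(G)$; $\xi_1(G)$ is the $\mathcal{E}$-spectral radius. $T^c$ is the complement of $T$. For $b\ge a\ge0$ with $a+b=n-4$, $T_{n,3}^{a,b}$ is the tree obtained from the path $v_0v_1v_2v_3$ by attaching $a$ pendant vertices to $v_1$ and $b$ pendant vertices to $v_2$; these are exactly the trees of diameter $3$ on $n$ vertices. *)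

theory Defs
  imports "Graph_Theory.Graph_Theory" "Jordan_Normal_Form.Spectral_Radius"
begin

text \<open>A finite simple graph is a \<^typ>\<open>'a pair_pre_digraph\<close> satisfying \<^locale>\<open>pair_graph\<close>:
  each edge is a pair of opposite arcs.\<close>

definition complement_graph :: "'a pair_pre_digraph \<Rightarrow> 'a pair_pre_digraph" where
  "complement_graph G = \<lparr> pverts = pverts G,
     parcs = {(u, v). u \<in> pverts G \<and> v \<in> pverts G \<and> u \<noteq> v \<and> (u, v) \<notin> parcs G} \<rparr>"

text \<open>Arbitrary (through \<open>Least\<close> of the empty set) if \<open>v\<close> is not reachable from \<open>u\<close>.\<close>

definition graph_dist :: "'a pair_pre_digraph \<Rightarrow> 'a \<Rightarrow> 'a \<Rightarrow> nat" where
  "graph_dist G u v = (LEAST k. \<exists>p. pre_digraph.awalk (with_proj G) u p v \<and> length p = k)"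

definition eccentricity :: "'a pair_pre_digraph \<Rightarrow> 'a \<Rightarrow> nat" where
  "eccentricity G u = Max ((\<lambda>v. graph_dist G u v) ` pverts G)"

text \<open>Rows and columns are listed in increasing order of the vertices.\<close>

definition ecc_matrix :: "'a::linorder pair_pre_digraph \<Rightarrow> real mat" where
  "ecc_matrix G = (let vs = sorted_list_of_set (pverts G) in
     mat (length vs) (length vs) (\<lambda>(i, j).
       let u = vs ! i; v = vs ! j in
       if graph_dist G u v = min (eccentricity G u) (eccentricity G v)
       then real (graph_dist G u v) else 0))"

text \<open>The matrix is real symmetric, so all its eigenvalues are real and the first one in
  decreasing order is the largest element of the spectrum over the reals.\<close>

definition ecc_xi1 :: "'a::linorder pair_pre_digraph \<Rightarrow> real" where
  "ecc_xi1 G = Max (spectrum (ecc_matrix G))"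

text \<open>The tree \<open>T\<close> with parameters \<open>a\<close> and \<open>b\<close>, on \<open>n = a + b + 4\<close> vertices: the path is
  \<open>0, 1, 2, 3\<close>, the pendant vertices at \<open>1\<close> are \<open>4, \<dots>, a + 3\<close>, and those at \<open>2\<close> are
  \<open>a + 4, \<dots>, a + b + 3\<close>.\<close>

definition tree_diam3 :: "nat \<Rightarrow> nat \<Rightarrow> nat pair_pre_digraph" where
  "tree_diam3 a b =
    (let A = {(0, 1), (1, 2), (2, 3)} \<union> {1} \<times> {4..<a + 4} \<union> {2} \<times> {a + 4..<a + b + 4}
     in \<lparr> pverts = {0..<a + b + 4}, parcs = A \<union> A\<inverse> \<rparr>)"

lemma graph_dist_eq_mu:
  assumes "pair_wf_digraph G" and "u \<rightarrow>\<^sup>*\<^bsub>with_proj G\<^esub> v"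
  shows "ereal (real (graph_dist G u v)) = wf_digraph.\<mu> (with_proj G) (\<lambda>_. 1) u v"
proof -
  interpret pair_wf_digraph G by fact
  let ?P = "\<lambda>k. \<exists>p. pre_digraph.awalk (with_proj G) u p v \<and> length p = k"
  have cost: "awalk_cost (\<lambda>_. 1) p = real (length p)" for p :: "('a \<times> 'a) list"
    by (induct p) auto
  have "\<exists>k. ?P k"
    using assms(2) reachable_awalk by auto
  then have "?P (graph_dist G u v)"
    unfolding graph_dist_def by (rule LeastI_ex)
  then obtain p where p: "awalk u p v" "length p = graph_dist G u v" by auto
  have le: "graph_dist G u v \<le> length q" if "awalk u q v" for q
    unfolding graph_dist_def by (rule Least_le) (use that in auto)
  show ?thesis
    unfolding \<mu>_def cost
    by (rule antisym) (use p le in \<open>auto intro!: INF_greatest INF_lower2[of p]\<close>)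
qed

lemma pair_graph_tree_diam3: "pair_graph (tree_diam3 a b)"
  by unfold_locales
    (auto simp: tree_diam3_def Let_def symmetric_def intro!: symI)

lemma pair_graph_complement_graph:
  assumes "pair_graph G"
  shows "pair_graph (complement_graph G)"
proof -
  interpret pair_graph G by fact
  have sub: "parcs (complement_graph G) \<subseteq> pverts G \<times> pverts G"
    by (auto simp: complement_graph_def)
  have sym: "(v, u) \<in> parcs G" if "(u, v) \<in> parcs G" for u v
    using that pair_sym_arcs by (auto simp: symmetric_def dest: symD)
  show ?thesis
  proof unfold_locales
    show "finite (parcs (complement_graph G))"
      using finite_subset[OF sub] by simp
  qed (auto simp: complement_graph_def symmetric_def intro!: symI dest: sym)
qed

lemma connected_complement_tree_diam3:
  "connected (with_proj (complement_graph (tree_diam3 a b)))"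
proof -
  let ?G = "complement_graph (tree_diam3 a b)"
  interpret pair_graph ?G
    using pair_graph_complement_graph[OF pair_graph_tree_diam3] .
  have to0: "u \<rightarrow>\<^sup>*\<^bsub>with_proj ?G\<^esub> 0" if u: "u \<in> pverts ?G" for u
  proof -
    consider "u = 0" | "u = 1" | "u \<ge> 2" by linarith
    then show ?thesis
    proof cases
      case 1
      then show ?thesis using u by auto
    next
      case 2
      have "(1, 3) \<in> parcs ?G" "(3, 0) \<in> parcs ?G"
        by (auto simp: complement_graph_def tree_diam3_def Let_def)
      from this[THEN reachable_adjI] show ?thesis
        unfolding 2 by (rule reachable_trans)
    next
      case 3
      then have "(u, 0) \<in> parcs ?G"
        using u by (auto simp: complement_graph_def tree_diam3_def Let_def)
      then show ?thesis by (rule reachable_adjI)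
    qed
  qed
  have "0 \<in> pverts ?G"
    by (simp add: complement_graph_def tree_diam3_def Let_def)
  moreover have "u \<rightarrow>\<^sup>*\<^bsub>with_proj ?G\<^esub> v" if "u \<in> pverts ?G" "v \<in> pverts ?G" for u v
    using to0[OF that(1)] symmetric_reachable[OF pair_sym_arcs to0[OF that(2)]]
    by (rule reachable_trans)
  ultimately show ?thesis
    by (intro connectedI) (auto simp: reachable_mk_symmetric_eq[OF pair_sym_arcs])
qed

end

theory Submission
  imports Defs
begin

text \<open>In the complement of \<open>tree_diam3 a b\<close> the two inner path vertices are at distance 3, a pendant
  vertex and its neighbour in the tree are at distance 2, and all other pairs are adjacent. So the
  eccentricity matrix is the adjacency matrix of the tree with weight 3 on the central edge and 2 on
  all other edges. With \<open>p = a + 1\<close> and \<open>q = b + 1\<close> pendant vertices on either side, eliminating the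
  pendant coordinates from the eigenvector equations shows that every nonzero eigenvalue \<open>t\<close>
  satisfies \<open>(t\<^sup>2 - 4 p) (t\<^sup>2 - 4 q) = 9 t\<^sup>2\<close>. The largest root depends on \<open>p + q\<close> and \<open>p q\<close> only, and
  for fixed \<open>p + q\<close> it decreases strictly in \<open>p q\<close>.\<close>

section \<open>Small distances\<close>

context
  fixes G :: "'a pair_pre_digraph"
  assumes wf: "pair_wf_digraph G"
begin

interpretation pair_wf_digraph G by (rule wf)

lemma graph_dist_eqI:
  assumes "awalk u p v" and "\<And>q. awalk u q v \<Longrightarrow> length p \<le> length q"
  shows "graph_dist G u v = length p"
  unfolding graph_dist_def by (rule Least_equality) (use assms in auto)

lemma graph_dist_self:
  assumes "u \<in> pverts G"
  shows "graph_dist G u u = 0"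
  using graph_dist_eqI[of u "[]" u] assms by (simp add: awalk_Nil_iff)

lemma awalk_length_pos:
  assumes "awalk u q v" and "u \<noteq> v"
  shows "1 \<le> length q"
  using assms by (cases q) (auto simp: awalk_simps)

text \<open>Removing the first arc leaves a walk between distinct vertices, since its start is
  adjacent to \<open>u\<close> and \<open>v\<close> is not.\<close>

lemma awalk_length_ge_2:
  assumes "awalk u q v" and "u \<noteq> v" and "(u, v) \<notin> parcs G"
  shows "2 \<le> length q"
proof (cases q)
  case Nil
  then show ?thesis using assms by (simp add: awalk_simps)
next
  case (Cons e r)
  have "1 \<le> length r"
  proof (rule awalk_length_pos)
    show "awalk (snd e) r v" using assms(1) Cons by (simp add: awalk_simps)
    show "snd e \<noteq> v" using assms Cons by (cases e) (auto simp: awalk_simps)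
  qed
  then show ?thesis using Cons by simp
qed

text \<open>Same reduction once more: after the first arc the walk stands at a neighbour of
  \<open>u\<close>, which is not \<open>v\<close> and, having no arc to \<open>v\<close>, is still
  at least two arcs away.\<close>

lemma awalk_length_ge_3:
  assumes "awalk u q v" and "u \<noteq> v" and "(u, v) \<notin> parcs G"
    and "\<And>w. (u, w) \<in> parcs G \<Longrightarrow> (w, v) \<notin> parcs G"
  shows "3 \<le> length q"
proof (cases q)
  case Nil
  then show ?thesis using assms by (simp add: awalk_simps)
next
  case (Cons e r)
  have "2 \<le> length r"
  proof (rule awalk_length_ge_2)
    show "awalk (snd e) r v" using assms(1) Cons by (simp add: awalk_simps)
    show "snd e \<noteq> v" using assms Cons by (cases e) (auto simp: awalk_simps)
    show "(snd e, v) \<notin> parcs G" using assms Cons by (cases e) (auto simp: awalk_simps)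
  qed
  then show ?thesis using Cons by simp
qed

lemma graph_dist_eq_1:
  assumes "u \<noteq> v" and "(u, v) \<in> parcs G"
  shows "graph_dist G u v = 1"
proof -
  have w: "awalk u [(u, v)] v"
    using assms wellformed[OF assms(2)] by (simp add: awalk_simps)
  have "graph_dist G u v = length [(u, v)]"
    by (rule graph_dist_eqI[OF w]) (drule awalk_length_pos[OF _ assms(1)], simp)
  then show ?thesis by simp
qed

lemma graph_dist_eq_2:
  assumes "u \<noteq> v" and "(u, v) \<notin> parcs G" and "(u, w) \<in> parcs G" and "(w, v) \<in> parcs G"
  shows "graph_dist G u v = 2"
proof -
  have w: "awalk u [(u, w), (w, v)] v"
    using assms wellformed[OF assms(3)] wellformed[OF assms(4)] by (simp add: awalk_simps)
  have "graph_dist G u v = length [(u, w), (w, v)]"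
    by (rule graph_dist_eqI[OF w]) (drule awalk_length_ge_2[OF _ assms(1,2)], simp)
  then show ?thesis by simp
qed

lemma graph_dist_eq_3:
  assumes "u \<noteq> v" and "(u, v) \<notin> parcs G" and "\<And>w. (u, w) \<in> parcs G \<Longrightarrow> (w, v) \<notin> parcs G"
    and "(u, x) \<in> parcs G" and "(x, y) \<in> parcs G" and "(y, v) \<in> parcs G"
  shows "graph_dist G u v = 3"
proof -
  have w: "awalk u [(u, x), (x, y), (y, v)] v"
    using assms(4-6) wellformed[OF assms(4)] wellformed[OF assms(5)] wellformed[OF assms(6)]
    by (simp add: awalk_simps)
  have "graph_dist G u v = length [(u, x), (x, y), (y, v)]"
    by (rule graph_dist_eqI[OF w]) (drule awalk_length_ge_3[OF _ assms(1-3)], simp_all)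
  then show ?thesis by simp
qed

end

section \<open>The eccentricity matrix of the complement\<close>

text \<open>Keeps the vertex \<open>1\<close> in the form in which the facts below mention it,
  instead of \<open>Suc 0\<close>.\<close>

declare One_nat_def [simp del]

section \<open>Pendant vertices and arcs of the tree\<close>

definition left_leaves :: "nat \<Rightarrow> nat set" where
  "left_leaves a = insert 0 {4..<a + 4}"

text \<open>The path ends \<open>0\<close> and \<open>3\<close> are grouped with the attached
  pendant vertices, as they play the same role; hence the sizes \<open>a + 1\<close> and
  \<open>b + 1\<close>.\<close>

definition right_leaves :: "nat \<Rightarrow> nat \<Rightarrow> nat set" where
  "right_leaves a b = insert 3 {a + 4..<a + b + 4}"

lemma card_left_leaves: "card (left_leaves a) = a + 1"
  by (simp add: left_leaves_def)

lemma card_right_leaves: "card (right_leaves a b) = b + 1"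
  by (simp add: right_leaves_def)

lemma finite_leaves [simp]: "finite (left_leaves a)" "finite (right_leaves a b)"
  by (simp_all add: left_leaves_def right_leaves_def)

lemma leaves_lessD:
  "i \<in> left_leaves a \<Longrightarrow> i < a + b + 4"
  "i \<in> right_leaves a b \<Longrightarrow> i < a + b + 4"
  by (auto simp: left_leaves_def right_leaves_def)

lemma leaves_disjoint:
  "1 \<notin> left_leaves a \<and> 2 \<notin> left_leaves a \<and> 1 \<notin> right_leaves a b \<and> 2 \<notin> right_leaves a b \<and>
    left_leaves a \<inter> right_leaves a b = {}"
  by (auto simp: left_leaves_def right_leaves_def)

lemma vertices_eq:
  "{0..<a + b + 4} = {1, 2} \<union> (left_leaves a \<union> right_leaves a b)"
  by (auto simp: left_leaves_def right_leaves_def)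

lemma tree_diam3_vertex_cases [consumes 1, case_names one two left right]:
  assumes "i < a + b + 4"
  obtains "i = 1" | "i = 2" | "i \<in> left_leaves a" | "i \<in> right_leaves a b"
proof -
  have "i \<in> {0..<a + b + 4}" using assms by simp
  then show ?thesis using that unfolding vertices_eq by blast
qed

lemma sum_vertices:
  fixes f :: "nat \<Rightarrow> real"
  shows "(\<Sum>j = 0..<a + b + 4. f j) =
    f 1 + f 2 + (\<Sum>j\<in>left_leaves a. f j) + (\<Sum>j\<in>right_leaves a b. f j)"
  unfolding vertices_eq using leaves_disjoint[of a b]
  by (subst sum.union_disjoint; (subst sum.union_disjoint)?) auto

text \<open>Natural-number valued so that it describes both the matrix entries and, up to a
  \<open>max\<close> with 1, the distances in the complement.\<close>

definition ecc_weight :: "nat \<Rightarrow> nat \<Rightarrow> nat \<Rightarrow> nat \<Rightarrow> nat" where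
  "ecc_weight a b i j =
    (if (i, j) \<in> {(1, 2), (2, 1)} then 3
     else if (i, j) \<in> parcs (tree_diam3 a b) then 2 else 0)"

lemma parcs_tree_diam3:
  "parcs (tree_diam3 a b) = {(1, 2), (2, 1)} \<union> {1} \<times> left_leaves a \<union> left_leaves a \<times> {1}
    \<union> {2} \<times> right_leaves a b \<union> right_leaves a b \<times> {2}"
  by (auto simp: tree_diam3_def Let_def left_leaves_def right_leaves_def)

lemma tree_diam3_pair_cases [case_names non_arc arc12 arc21 arc1L arcL1 arc2R arcR2]:
  obtains "(i, j) \<notin> parcs (tree_diam3 a b)"
    | "i = 1" "j = 2" | "i = 2" "j = 1"
    | "i = 1" "j \<in> left_leaves a" | "i \<in> left_leaves a" "j = 1"
    | "i = 2" "j \<in> right_leaves a b" | "i \<in> right_leaves a b" "j = 2"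
  unfolding parcs_tree_diam3 by blast

lemma tree_diam3_arcs:
  "(1, 2) \<in> parcs (tree_diam3 a b)" "(2, 1) \<in> parcs (tree_diam3 a b)"
  "i \<in> left_leaves a \<Longrightarrow> (1, i) \<in> parcs (tree_diam3 a b)"
  "i \<in> left_leaves a \<Longrightarrow> (i, 1) \<in> parcs (tree_diam3 a b)"
  "i \<in> right_leaves a b \<Longrightarrow> (2, i) \<in> parcs (tree_diam3 a b)"
  "i \<in> right_leaves a b \<Longrightarrow> (i, 2) \<in> parcs (tree_diam3 a b)"
  unfolding parcs_tree_diam3 by blast+

lemma left_leavesD:
  assumes "i \<in> left_leaves a"
  shows "i \<noteq> 1" "i \<noteq> 2" "i \<notin> right_leaves a b"
  using assms leaves_disjoint[of a b] by blast+

lemma right_leavesD: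
  assumes "i \<in> right_leaves a b"
  shows "i \<noteq> 1" "i \<noteq> 2" "i \<notin> left_leaves a"
  using assms leaves_disjoint[of a b] by blast+

lemma tree_diam3_non_arcs:
  "(i, i) \<notin> parcs (tree_diam3 a b)"
  "i \<in> left_leaves a \<Longrightarrow> (2, i) \<notin> parcs (tree_diam3 a b)"
  "i \<in> left_leaves a \<Longrightarrow> (i, 2) \<notin> parcs (tree_diam3 a b)"
  "i \<in> right_leaves a b \<Longrightarrow> (1, i) \<notin> parcs (tree_diam3 a b)"
  "i \<in> right_leaves a b \<Longrightarrow> (i, 1) \<notin> parcs (tree_diam3 a b)"
  "\<lbrakk>i \<in> left_leaves a \<union> right_leaves a b; j \<in> left_leaves a \<union> right_leaves a b\<rbrakk>
    \<Longrightarrow> (i, j) \<notin> parcs (tree_diam3 a b)"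
  unfolding parcs_tree_diam3 using leaves_disjoint[of a b] by auto

lemma ecc_weight_eqs:
  "ecc_weight a b 1 2 = 3" "ecc_weight a b 2 1 = 3"
  "i \<in> left_leaves a \<Longrightarrow> ecc_weight a b 1 i = 2"
  "i \<in> left_leaves a \<Longrightarrow> ecc_weight a b i 1 = 2"
  "i \<in> right_leaves a b \<Longrightarrow> ecc_weight a b 2 i = 2"
  "i \<in> right_leaves a b \<Longrightarrow> ecc_weight a b i 2 = 2"
  "(i, j) \<notin> parcs (tree_diam3 a b) \<Longrightarrow> ecc_weight a b i j = 0"
  using tree_diam3_arcs[of a b] tree_diam3_arcs(3-)[of i a b] left_leavesD(1,2)[of i a] right_leavesD(1,2)[of i a b]
  by (auto simp: ecc_weight_def)

section \<open>Distances and eccentricities in the complement\<close>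

lemma pverts_complement_tree: "pverts (complement_graph (tree_diam3 a b)) = {0..<a + b + 4}"
  by (simp add: complement_graph_def tree_diam3_def Let_def)

lemma parcs_complement_tree:
  "(i, j) \<in> parcs (complement_graph (tree_diam3 a b)) \<longleftrightarrow>
    i < a + b + 4 \<and> j < a + b + 4 \<and> i \<noteq> j \<and> (i, j) \<notin> parcs (tree_diam3 a b)"
  by (simp add: complement_graph_def tree_diam3_def Let_def)

text \<open>Tree arcs are exactly the pairs of distinct vertices that lose adjacency. A left leaf
  and \<open>1\<close> share the neighbour \<open>3\<close> in the complement, a right leaf and
  \<open>2\<close> share \<open>0\<close>, while \<open>1\<close> and \<open>2\<close> share none.
  The \<open>max\<close> turns weight 0 into distance 1 for adjacent pairs.\<close>

lemma graph_dist_complement_tree: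
  assumes "i < a + b + 4" and "j < a + b + 4"
  shows "graph_dist (complement_graph (tree_diam3 a b)) i j =
    (if i = j then 0 else max 1 (ecc_weight a b i j))"
proof -
  let ?G = "complement_graph (tree_diam3 a b)"
  have wf: "pair_wf_digraph ?G"
    using pair_graph_complement_graph[OF pair_graph_tree_diam3]
    by (simp add: pair_graph_def pair_digraph_def pair_fin_digraph_def)
  have leaf: "0 \<in> left_leaves a" "3 \<in> right_leaves a b"
    by (auto simp: left_leaves_def right_leaves_def)
  have cross: "(x, y) \<in> parcs ?G" "(y, x) \<in> parcs ?G"
    if "x \<in> left_leaves a" "y \<in> right_leaves a b" for x y
    using tree_diam3_non_arcs(6)[of x a b y] tree_diam3_non_arcs(6)[of y a b x] that
      left_leavesD[OF that(1)] leaves_lessD(1)[OF that(1)] leaves_lessD(2)[OF that(2)]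
    unfolding parcs_complement_tree by auto
  have from1: "(1, y) \<in> parcs ?G" "(y, 1) \<in> parcs ?G" if "y \<in> right_leaves a b" for y
    using tree_diam3_non_arcs(4,5)[OF that] right_leavesD[OF that] leaves_lessD(2)[OF that]
    unfolding parcs_complement_tree by auto
  have from2: "(2, x) \<in> parcs ?G" "(x, 2) \<in> parcs ?G" if "x \<in> left_leaves a" for x
    using tree_diam3_non_arcs(2,3)[OF that] left_leavesD[OF that] leaves_lessD(1)[OF that]
    unfolding parcs_complement_tree by auto
  have tree: "(x, y) \<notin> parcs ?G" if "(x, y) \<in> parcs (tree_diam3 a b)" for x y
    using that by (simp add: parcs_complement_tree)
  \<comment> \<open>Every vertex is adjacent in the tree to \<open>1\<close> or to \<open>2\<close>,
    so in the complement none is adjacent to both. The case \<open>w \<ge> a + b + 4\<close> covers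
    numbers that are not vertices.\<close>
  have no_common: "(1, w) \<notin> parcs ?G \<or> (w, 2) \<notin> parcs ?G"
    "(2, w) \<notin> parcs ?G \<or> (w, 1) \<notin> parcs ?G" for w
  proof -
    consider "w \<ge> a + b + 4" | "w = 1" | "w = 2" | "w \<in> left_leaves a" | "w \<in> right_leaves a b"
      using tree_diam3_vertex_cases[of w a b] by (metis not_le)
    then show "(1, w) \<notin> parcs ?G \<or> (w, 2) \<notin> parcs ?G"
      "(2, w) \<notin> parcs ?G \<or> (w, 1) \<notin> parcs ?G"
      using tree_diam3_arcs by (cases; simp add: parcs_complement_tree)+
  qed
  show ?thesis
  proof (cases "i = j")
    case True
    then show ?thesis using graph_dist_self[OF wf, of i] assms by (simp add: pverts_complement_tree)
  next
    case False
    show ?thesis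
    proof (cases i j a b rule: tree_diam3_pair_cases)
      case non_arc
      then have "graph_dist ?G i j = 1"
        using False assms by (intro graph_dist_eq_1[OF wf]) (simp_all add: parcs_complement_tree)
      then show ?thesis using False non_arc by (simp add: ecc_weight_eqs)
    next
      case arc12
      have "graph_dist ?G 1 2 = 3"
      proof (rule graph_dist_eq_3[OF wf])
        show "(1, 2) \<notin> parcs ?G" using tree tree_diam3_arcs by blast
        show "(w, 2) \<notin> parcs ?G" if "(1, w) \<in> parcs ?G" for w
          using no_common(1) that by blast
        \<comment> \<open>A shortest path crosses between the two leaf classes: 1, 3, 0, 2.\<close>
        show "(1, 3) \<in> parcs ?G" "(3, 0) \<in> parcs ?G" "(0, 2) \<in> parcs ?G"
          using from1 from2 cross leaf by blast+
      qed simp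
      then show ?thesis using arc12 by (simp add: ecc_weight_eqs)
    next
      case arc21
      have "graph_dist ?G 2 1 = 3"
      proof (rule graph_dist_eq_3[OF wf])
        show "(2, 1) \<notin> parcs ?G" using tree tree_diam3_arcs by blast
        show "(w, 1) \<notin> parcs ?G" if "(2, w) \<in> parcs ?G" for w
          using no_common(2) that by blast
        show "(2, 0) \<in> parcs ?G" "(0, 3) \<in> parcs ?G" "(3, 1) \<in> parcs ?G"
          using from1 from2 cross leaf by blast+
      qed simp
      then show ?thesis using arc21 by (simp add: ecc_weight_eqs)
    next
      case arc1L
      have "graph_dist ?G i j = 2"
        using tree[OF tree_diam3_arcs(3)] from1[OF leaf(2)] cross[OF _ leaf(2)] arc1L False
        by (intro graph_dist_eq_2[OF wf, of i j 3]) simp_all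
      then show ?thesis using False arc1L by (simp add: ecc_weight_eqs)
    next
      case arcL1
      have "graph_dist ?G i j = 2"
        using tree[OF tree_diam3_arcs(4)] from1[OF leaf(2)] cross[OF _ leaf(2)] arcL1 False
        by (intro graph_dist_eq_2[OF wf, of i j 3]) simp_all
      then show ?thesis using False arcL1 by (simp add: ecc_weight_eqs)
    next
      case arc2R
      have "graph_dist ?G i j = 2"
        using tree[OF tree_diam3_arcs(5)] from2[OF leaf(1)] cross[OF leaf(1)] arc2R False
        by (intro graph_dist_eq_2[OF wf, of i j 0]) simp_all
      then show ?thesis using False arc2R by (simp add: ecc_weight_eqs)
    next
      case arcR2
      have "graph_dist ?G i j = 2"
        using tree[OF tree_diam3_arcs(6)] from2[OF leaf(1)] cross[OF leaf(1)] arcR2 False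
        by (intro graph_dist_eq_2[OF wf, of i j 0]) simp_all
      then show ?thesis using False arcR2 by (simp add: ecc_weight_eqs)
    qed
  qed
qed

text \<open>The maximum is attained at a tree neighbour: \<open>1\<close> and \<open>2\<close> serve
  each other, and each leaf uses the inner vertex it hangs from.\<close>

lemma eccentricity_complement_tree:
  assumes "i < a + b + 4"
  shows "eccentricity (complement_graph (tree_diam3 a b)) i = (if i \<in> {1, 2} then 3 else 2)"
proof -
  let ?G = "complement_graph (tree_diam3 a b)"
  have le: "graph_dist ?G i j \<le> (if i \<in> {1, 2} then 3 else 2)" if "j < a + b + 4" for j
    unfolding graph_dist_complement_tree[OF assms that] by (auto simp: ecc_weight_def)
  have "\<exists>j < a + b + 4. graph_dist ?G i j = (if i \<in> {1, 2} then 3 else 2)"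
    using assms
  proof (cases i a b rule: tree_diam3_vertex_cases)
    case one
    then show ?thesis
      by (intro exI[of _ 2]) (simp add: graph_dist_complement_tree ecc_weight_eqs)
  next
    case two
    then show ?thesis
      by (intro exI[of _ 1]) (simp add: graph_dist_complement_tree ecc_weight_eqs)
  next
    case left
    then show ?thesis using left_leavesD[OF left] assms
      by (intro exI[of _ 1]) (simp add: graph_dist_complement_tree ecc_weight_eqs)
  next
    case right
    then show ?thesis using right_leavesD[OF right] assms
      by (intro exI[of _ 2]) (simp add: graph_dist_complement_tree ecc_weight_eqs)
  qed
  then obtain j where "j < a + b + 4" "graph_dist ?G i j = (if i \<in> {1, 2} then 3 else 2)"
    by blast
  then show ?thesis
    unfolding eccentricity_def pverts_complement_tree using le
    by (intro Max_eqI) (force simp del: insert_iff)+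
qed

text \<open>The minimum of the two eccentricities is 3 only if both vertices lie in
  \<open>{1, 2}\<close>, and 2 otherwise. So distances 0 and 1 are discarded, while the 3 of the
  central edge and the 2 of the leaf edges survive.\<close>

lemma ecc_matrix_complement_tree:
  "ecc_matrix (complement_graph (tree_diam3 a b)) =
    mat (a + b + 4) (a + b + 4) (\<lambda>(i, j). real (ecc_weight a b i j))"
proof -
  let ?G = "complement_graph (tree_diam3 a b)"
  have entry: "ecc_weight a b i j =
      (if graph_dist ?G i j = min (eccentricity ?G i) (eccentricity ?G j) then graph_dist ?G i j
       else 0)"
    if "i < a + b + 4" "j < a + b + 4" for i j
    unfolding graph_dist_complement_tree[OF that] eccentricity_complement_tree[OF that(1)]
      eccentricity_complement_tree[OF that(2)]
    by (cases i j a b rule: tree_diam3_pair_cases)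
      (auto simp: ecc_weight_eqs tree_diam3_non_arcs dest: left_leavesD right_leavesD)
  show ?thesis
    unfolding ecc_matrix_def pverts_complement_tree Let_def
    by (rule eq_matI) (simp_all add: entry)
qed

section \<open>The spectral radius\<close>

text \<open>The eigenvector equation read row by row, by vertex type. Vectors become functions on
  all of \<open>nat\<close>, so the condition of being nonzero has to be restricted to indices of
  vertices.\<close>

lemma spectrum_ecc_matrix_iff:
  "t \<in> spectrum (ecc_matrix (complement_graph (tree_diam3 a b))) \<longleftrightarrow>
    (\<exists>f :: nat \<Rightarrow> real. (\<exists>i < a + b + 4. f i \<noteq> 0) \<and>
      3 * f 2 + 2 * (\<Sum>j\<in>left_leaves a. f j) = t * f 1 \<and>
      3 * f 1 + 2 * (\<Sum>j\<in>right_leaves a b. f j) = t * f 2 \<and>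
      (\<forall>i\<in>left_leaves a. 2 * f 1 = t * f i) \<and>
      (\<forall>i\<in>right_leaves a b. 2 * f 2 = t * f i))"
  (is "_ \<longleftrightarrow> (\<exists>f. ?nz f \<and> ?eqs f)")
proof -
  let ?N = "a + b + 4"
  let ?M = "mat ?N ?N (\<lambda>(i, j). real (ecc_weight a b i j))"
  let ?S = "\<lambda>f i. \<Sum>j = 0..<?N. real (ecc_weight a b i j) * f j"
  note w = ecc_weight_eqs tree_diam3_non_arcs
  have S: "?S f 1 = 3 * f 2 + 2 * (\<Sum>j\<in>left_leaves a. f j)"
    "?S f 2 = 3 * f 1 + 2 * (\<Sum>j\<in>right_leaves a b. f j)"
    "i \<in> left_leaves a \<Longrightarrow> ?S f i = 2 * f 1"
    "i \<in> right_leaves a b \<Longrightarrow> ?S f i = 2 * f 2" for f :: "nat \<Rightarrow> real" and i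
    unfolding sum_vertices by (simp_all add: w sum_distrib_left)
  have rows: "(\<forall>i < ?N. ?S f i = t * f i) \<longleftrightarrow> ?eqs f" for f :: "nat \<Rightarrow> real"
  proof
    assume *: "\<forall>i < ?N. ?S f i = t * f i"
    have "?S f 1 = t * f 1" "?S f 2 = t * f 2" using * by simp_all
    moreover have "?S f i = t * f i" if "i \<in> left_leaves a \<union> right_leaves a b" for i
      using that * leaves_lessD[of i a b] by blast
    ultimately show "?eqs f" unfolding S(1,2) using S(3,4)[of _ f] by (metis Un_iff)
  next
    assume eqs: "?eqs f"
    show "\<forall>i < ?N. ?S f i = t * f i"
    proof (intro allI impI)
      fix i assume "i < ?N"
      then show "?S f i = t * f i"
        by (cases i a b rule: tree_diam3_vertex_cases) (use eqs S(1,2)[of f] S(3,4)[of i f] in auto)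
    qed
  qed
  have vec: "eigenvector ?M v t \<longleftrightarrow>
      v \<in> carrier_vec ?N \<and> ?nz (($) v) \<and> (\<forall>i < ?N. ?S (($) v) i = t * v $ i)" for v
  proof (cases "v \<in> carrier_vec ?N")
    case True
    have nz: "v \<noteq> 0\<^sub>v ?N \<longleftrightarrow> ?nz (($) v)"
      using True by (auto simp: vec_eq_iff)
    have "(?M *\<^sub>v v) $ i = ?S (($) v) i" if "i < ?N" for i
    proof -
      have "dim_vec v = ?N" using True by auto
      then have "(?M *\<^sub>v v) $ i = (\<Sum>j = 0..<?N. row ?M i $ j * v $ j)"
        using that by (simp only: index_mult_mat_vec dim_row_mat scalar_prod_def)
      also have "\<dots> = ?S (($) v) i"
        using that by (intro sum.cong) auto
      finally show ?thesis .
    qed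
    then have "?M *\<^sub>v v = t \<cdot>\<^sub>v v \<longleftrightarrow> (\<forall>i < ?N. ?S (($) v) i = t * v $ i)"
      using True by (auto simp: vec_eq_iff simp del: index_mult_mat_vec)
    then show ?thesis
      using True nz unfolding eigenvector_def by (simp only: dim_row_mat)
  qed (simp add: eigenvector_def)
  have "t \<in> spectrum ?M \<longleftrightarrow> (\<exists>f. ?nz f \<and> (\<forall>i < ?N. ?S f i = t * f i))"
  proof
    assume "t \<in> spectrum ?M"
    then obtain v where "eigenvector ?M v t"
      unfolding spectrum_def eigenvalue_def by blast
    then show "\<exists>f. ?nz f \<and> (\<forall>i < ?N. ?S f i = t * f i)"
      unfolding vec by (intro exI[of _ "($) v"]) blast
  next
    assume "\<exists>f. ?nz f \<and> (\<forall>i < ?N. ?S f i = t * f i)"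
    then obtain f where f: "?nz f" "\<forall>i < ?N. ?S f i = t * f i" by blast
    have "eigenvector ?M (vec ?N f) t"
      unfolding vec using f by auto
    then show "t \<in> spectrum ?M" unfolding spectrum_def eigenvalue_def by blast
  qed
  then show ?thesis unfolding ecc_matrix_complement_tree rows .
qed

text \<open>For \<open>s = p + q\<close> and \<open>d = p * q\<close> this is the larger root of m^2
  - (4 s + 9) m + 16 d = 0, which is (m - 4 p) (m - 4 q) = 9 m expanded.\<close>

definition xi1_sq :: "real \<Rightarrow> real \<Rightarrow> real" where
  "xi1_sq s d = (4 * s + 9 + sqrt ((4 * s + 9)\<^sup>2 - 64 * d)) / 2"

text \<open>16 (p + q)^2 - 64 p q = 16 (p - q)^2 makes the discriminant a sum of nonnegative
  terms.\<close>

lemma discriminant_nonneg: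
  fixes p q :: real
  assumes "0 \<le> p" and "0 \<le> q"
  shows "0 \<le> (4 * (p + q) + 9)\<^sup>2 - 64 * (p * q)"
proof -
  have "(4 * (p + q) + 9)\<^sup>2 - 64 * (p * q) = 16 * (p - q)\<^sup>2 + 72 * (p + q) + 81"
    by (simp add: power2_eq_square algebra_simps)
  then show ?thesis using assms by simp
qed

lemma xi1_sq_root:
  fixes p q :: real
  assumes "0 \<le> p" and "0 \<le> q"
  defines "m \<equiv> xi1_sq (p + q) (p * q)"
  shows "(m - 4 * p) * (m - 4 * q) = 9 * m"
proof -
  let ?D = "(4 * (p + q) + 9)\<^sup>2 - 64 * (p * q)"
  have "2 * ((x + y) / 2) - x = y" for x y :: real
    by (simp add: field_simps)
  then have "2 * m - (4 * (p + q) + 9) = sqrt ?D"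
    unfolding m_def xi1_sq_def .
  then have "(2 * m - (4 * (p + q) + 9))\<^sup>2 = ?D"
    using discriminant_nonneg[OF assms(1,2)] by (simp only: real_sqrt_pow2)
  then show ?thesis by (simp add: power2_eq_square algebra_simps)
qed

text \<open>Completing the square gives (2 m - (4 s + 9))^2 equal to the discriminant, and a real
  number is at most the square root of its square.\<close>

lemma root_le_xi1_sq:
  fixes p q m :: real
  assumes "(m - 4 * p) * (m - 4 * q) = 9 * m"
  shows "m \<le> xi1_sq (p + q) (p * q)"
proof -
  have "(2 * m - (4 * (p + q) + 9))\<^sup>2 = (4 * (p + q) + 9)\<^sup>2 - 64 * (p * q)"
    using assms by (simp add: power2_eq_square algebra_simps)
  then have "2 * m - (4 * (p + q) + 9) \<le> sqrt ((4 * (p + q) + 9)\<^sup>2 - 64 * (p * q))"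
    by (metis real_sqrt_abs abs_ge_self)
  then show ?thesis by (simp add: xi1_sq_def)
qed

text \<open>An explicit eigenvector shows that \<open>sqrt m\<close> is attained; conversely the
  square of any positive eigenvalue is a root of the quadratic, hence at most
  \<open>m\<close>.\<close>

lemma ecc_xi1_complement_tree:
  "ecc_xi1 (complement_graph (tree_diam3 a b)) =
    sqrt (xi1_sq (real (a + b + 2)) (real ((a + 1) * (b + 1))))"
proof -
  let ?M = "ecc_matrix (complement_graph (tree_diam3 a b))"
  define p q where "p = real (a + 1)" and "q = real (b + 1)"
  define m where "m = xi1_sq (p + q) (p * q)"
  have pq: "0 < p" "0 < q" by (auto simp: p_def q_def)
  have m_eq: "(m - 4 * p) * (m - 4 * q) = 9 * m"
    unfolding m_def using pq by (intro xi1_sq_root) auto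
  have m_pos: "0 < m"
    unfolding m_def xi1_sq_def using pq discriminant_nonneg[of p q]
    by (simp add: add_pos_nonneg)
  define t where "t = sqrt m"
  have t: "0 < t" "t * t = m" using m_pos by (auto simp: t_def)
  have "t \<in> spectrum ?M"
  proof -
    \<comment> \<open>Eliminating the left leaves gives (m - 4 p) f(1) = 3 t f(2), solved by f(1) =
      3 t and f(2) = m - 4 p. The leaf equations then force 2 f(1) / t = 6 and 2 f(2) / t.\<close>
    define f where "f i = (if i = 1 then 3 * t else if i = 2 then m - 4 * p
      else if i \<in> left_leaves a then 6 else 2 * (m - 4 * p) / t)" for i :: nat
    have f: "f 1 = 3 * t" "f 2 = m - 4 * p" by (simp_all add: f_def)
    have fl: "f i = 6" if "i \<in> left_leaves a" for i
      using that left_leavesD(1,2)[OF that] by (simp add: f_def)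
    have fr: "f i = 2 * (m - 4 * p) / t" if "i \<in> right_leaves a b" for i
      using right_leavesD[OF that] by (simp add: f_def)
    have suml: "(\<Sum>j\<in>left_leaves a. f j) = p * 6"
      by (simp add: fl card_left_leaves p_def)
    have sumr: "(\<Sum>j\<in>right_leaves a b. f j) = q * (2 * (m - 4 * p) / t)"
      by (simp add: fr card_right_leaves q_def)
    have "3 * f 2 + 2 * (\<Sum>j\<in>left_leaves a. f j) = t * f 1"
      unfolding suml f using t(2) by (simp add: algebra_simps)
    moreover have "3 * f 1 + 2 * (\<Sum>j\<in>right_leaves a b. f j) = t * f 2"
    proof -
      \<comment> \<open>The equation at vertex \<open>2\<close> is checked after multiplication by
        \<open>t\<close>, where it becomes the defining equation of \<open>m\<close>; the positive
        factor is cancelled at the end.\<close>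
      have "t * (3 * (3 * t) + 2 * (q * (2 * (m - 4 * p) / t))) = 9 * (t * t) + 4 * q * (m - 4 * p)"
        using t(1) by (simp add: field_simps)
      also have "\<dots> = m * (m - 4 * p)"
        unfolding t(2) using m_eq by (simp add: algebra_simps)
      also have "\<dots> = t * (t * (m - 4 * p))"
        by (simp add: t(2) flip: mult.assoc)
      finally show ?thesis unfolding sumr f using t(1) by simp
    qed
    moreover have "\<exists>i < a + b + 4. f i \<noteq> 0"
      using t(1) f(1) by (intro exI[of _ 1]) simp
    moreover have "\<forall>i\<in>left_leaves a. 2 * f 1 = t * f i"
      by (simp add: f fl)
    moreover have "\<forall>i\<in>right_leaves a b. 2 * f 2 = t * f i"
      using t(1) by (simp add: f fr)
    ultimately show ?thesis unfolding spectrum_ecc_matrix_iff by blast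
  qed
  moreover have "x \<le> t" if "x \<in> spectrum ?M" for x
  \<comment> \<open>Nonpositive eigenvalues are below \<open>t\<close> at once; this also sets aside
    \<open>x = 0\<close>, for which the leaf equations do not determine the leaf
    coordinates.\<close>
  proof (cases "x \<le> 0")
    case True
    then show ?thesis using t by simp
  next
    case False
    then have x: "0 < x" by simp
    from that obtain f :: "nat \<Rightarrow> real" where nz: "\<exists>i < a + b + 4. f i \<noteq> 0"
      and f1: "3 * f 2 + 2 * (\<Sum>j\<in>left_leaves a. f j) = x * f 1"
      and f2: "3 * f 1 + 2 * (\<Sum>j\<in>right_leaves a b. f j) = x * f 2"
      and fl: "\<And>i. i \<in> left_leaves a \<Longrightarrow> 2 * f 1 = x * f i"
      and fr: "\<And>i. i \<in> right_leaves a b \<Longrightarrow> 2 * f 2 = x * f i"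
      unfolding spectrum_ecc_matrix_iff by blast
    have "x * (\<Sum>j\<in>left_leaves a. f j) = (\<Sum>j\<in>left_leaves a. 2 * f 1)"
      unfolding sum_distrib_left using fl by (intro sum.cong) auto
    then have l: "x * (\<Sum>j\<in>left_leaves a. f j) = 2 * p * f 1"
      by (simp add: card_left_leaves p_def)
    have "x * (\<Sum>j\<in>right_leaves a b. f j) = (\<Sum>j\<in>right_leaves a b. 2 * f 2)"
      unfolding sum_distrib_left using fr by (intro sum.cong) auto
    then have r: "x * (\<Sum>j\<in>right_leaves a b. f j) = 2 * q * f 2"
      by (simp add: card_right_leaves q_def)
    \<comment> \<open>Multiplying the inner equations by \<open>x\<close> lets the leaf sums be
      replaced by \<open>l\<close> and \<open>r\<close>, leaving a 2 by 2 system in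
      \<open>f 1\<close> and \<open>f 2\<close>.\<close>
    have e1: "(x\<^sup>2 - 4 * p) * f 1 = 3 * x * f 2"
      using arg_cong[OF f1, of "(*) x"] l by (simp add: power2_eq_square algebra_simps)
    have e2: "(x\<^sup>2 - 4 * q) * f 2 = 3 * x * f 1"
      using arg_cong[OF f2, of "(*) x"] r by (simp add: power2_eq_square algebra_simps)
    \<comment> \<open>If \<open>f 1\<close> vanished, \<open>e1\<close> would kill
      \<open>f 2\<close> and the leaf equations every leaf coordinate. This licenses cancelling
      \<open>f 1\<close> from the product of \<open>e1\<close> and \<open>e2\<close>.\<close>
    have "f 1 \<noteq> 0"
    proof
      assume "f 1 = 0"
      then have "f 2 = 0" using e1 x by simp
      have "f i = 0" if "i < a + b + 4" for i
        using that \<open>f 1 = 0\<close> \<open>f 2 = 0\<close> x fl fr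
        by (cases i a b rule: tree_diam3_vertex_cases) auto
      then show False using nz by blast
    qed
    moreover have "(x\<^sup>2 - 4 * p) * (x\<^sup>2 - 4 * q) * f 1 = 9 * x\<^sup>2 * f 1"
    proof -
      have "(x\<^sup>2 - 4 * p) * (x\<^sup>2 - 4 * q) * f 1 = (x\<^sup>2 - 4 * q) * ((x\<^sup>2 - 4 * p) * f 1)"
        by (simp add: mult_ac)
      also have "\<dots> = 3 * x * ((x\<^sup>2 - 4 * q) * f 2)"
        unfolding e1 by (simp add: mult_ac)
      finally show ?thesis unfolding e2 by (simp add: power2_eq_square mult_ac)
    qed
    ultimately have "x\<^sup>2 \<le> m"
      unfolding m_def by (intro root_le_xi1_sq) simp
    then show ?thesis unfolding t_def by (rule real_le_rsqrt)
  qed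
  moreover have "finite (spectrum ?M)"
    unfolding ecc_matrix_complement_tree by (rule card_finite_spectrum) (rule mat_carrier)
  ultimately have "ecc_xi1 (complement_graph (tree_diam3 a b)) = t"
    unfolding ecc_xi1_def by (intro Max_eqI) auto
  moreover have "p + q = real (a + b + 2)" "p * q = real ((a + 1) * (b + 1))"
    by (simp_all add: p_def q_def)
  ultimately show ?thesis by (simp add: t_def m_def)
qed

text \<open>The second argument enters only through -64 d under the root, and \<open>sqrt\<close> in
  Isabelle is strictly increasing on all reals, being extended oddly to the negative ones.\<close>

lemma xi1_sq_strict_antimono:
  assumes "d < e"
  shows "xi1_sq s e < xi1_sq s d"
  using assms by (simp add: xi1_sq_def)

theorem theorem3p1:
  fixes n a a' :: nat
  assumes "4 \<le> n" and "a < a'" and "a' \<le> (n - 4) div 2"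
  shows "ecc_xi1 (complement_graph (tree_diam3 a (n - 4 - a)))
       > ecc_xi1 (complement_graph (tree_diam3 a' (n - 4 - a')))"
proof -
  define k where "k = n - 4"
  have k: "2 * a' \<le> k" "a < a'" using assms by (auto simp: k_def)
  define c where "c = a' - a"
  \<comment> \<open>With the shift \<open>c\<close> and the remaining imbalance \<open>r\<close>,
    all truncated subtractions become sums.\<close>
  define r where "r = k - 2 * a'"
  have a': "a' = a + c" and "k = 2 * a + 2 * c + r" and c: "0 < c"
    using k by (auto simp: c_def r_def)
  then have diff: "k - a = a + 2 * c + r" "k - a' = a + c + r"
    by auto
  \<comment> \<open>With the sum fixed, the more balanced pair has the larger product, here by
    exactly c (c + r) > 0.\<close>
  have "(a' + 1) * (k - a' + 1) = (a + 1) * (k - a + 1) + c * (c + r)"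
    unfolding diff unfolding a' by (simp add: algebra_simps)
  then have less: "(a + 1) * (k - a + 1) < (a' + 1) * (k - a' + 1)"
    using c by simp
  have sum: "a + (k - a) + 2 = k + 2" "a' + (k - a') + 2 = k + 2" using k by auto
  show ?thesis
    unfolding ecc_xi1_complement_tree k_def[symmetric] sum real_sqrt_less_iff
    by (rule xi1_sq_strict_antimono) (use less in \<open>simp only: of_nat_less_iff\<close>)
qed

end
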